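(* Let $(\Omega,\mathcal{F})$ be a measurable space and let $\mathcal{P}$ and $\mathcal{Q}$ be non-empty convex sets of probability measures on $(\Omega,\mathcal{F})$ such that $\mathcal{Q}\lll\mathcal{P}$. Assume that $l(\mathbb{L}^{\infty})=E'$. Assume that for some fixed $\varepsilon>0$ and $\delta>0$ the following holds: for each $A\in\mathcal{F}$ such that there exists $P\in\mathcal{P}$ with $P(A)<\delta$, there exists $Q\in\mathcal{Q}$ with $Q(A)<\varepsilon$. Then for each $P\in\mathcal{P}$ there exists $Q\in\mathcal{Q}$ such that for each $A\in\mathcal{F}$ with $P(A)<\varepsilon\delta$ we have $Q(A)<2\varepsilon$.
   Context: For sets $\mathcal{R},\mathcal{P}$ of probability measures on $(\Omega,\mathcal{F})$, $\mathcal{R}\lll\mathcal{P}$ means that for every $R\in\mathcal{R}$ there exists $P\in\mathcal{P}$ with $R\ll P$. A set $A'\subset\Omega$ is $\mathcal{P}$-polar if $A'\subset A$ for some $A\in\mathcal{F}$ with $P(A)=0$ for all $P\in\mathcal{P}$; a property holds $\mathcal{P}$-quasi-surely ($\mathcal{P}$-q.s.) if it holds outside a $\mathcal{P}$-polar set. $\mathcal{L}^\infty$ is the set of $\mathcal{F}$-measurable $X:\Omega\to\mathbb{R}$ for which there is a constant $M$ with $|X|\le M$ $\mathcal{P}$-q.s.; $\mathbb{L}^{\infty}=\mathcal{L}^\infty/\mathcal{N}$, where $\mathcal{N}$ is the set of measurable functions equal to $0$ $\mathcal{P}$-q.s.; the norm is $\|X\|_{\mathbb{L}^\infty}=\inf\{M\ge0:|X|\le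 M\ \mathcal{P}\text{-q.s.}\}$. $E$ is the space of all finite signed measures on $\mathcal{F}$ that are absolutely continuous with respect to at least one $P\in\mathcal{P}$, equipped with the total variation norm; $E'$ is its (topological) dual. The map $l:\mathbb{L}^\infty\to E'$, $h\mapsto l_h$, is given by $l_h(\mu)=\int_\Omega h\,d\mu$ for $\mu\in E$, and $l(\mathbb{L}^\infty)$ is its image. *)

theory Defs
  imports "HOL-Probability.Probability"
begin

text \<open>
  A measurable space is given by a value \<open>M :: 'a measure\<close> of which only \<open>space M\<close> and \<open>sets M\<close>
  are used. A set of probability measures on it is a subset of \<open>space (prob_algebra M)\<close>.
\<close>

section \<open>Sets of probability measures\<close>

definition mixture :: "'a measure \<Rightarrow> real \<Rightarrow> 'a measure \<Rightarrow> 'a measure \<Rightarrow> 'a measure" where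
  "mixture M t P R = measure_of (space M) (sets M)
     (\<lambda>A. ennreal t * emeasure P A + ennreal (1 - t) * emeasure R A)"

lemma sets_mixture [simp]: "sets (mixture M t P R) = sets M"
  by (simp add: mixture_def)

lemma emeasure_mixture:
  assumes "sets P = sets M" "sets R = sets M" "A \<in> sets M"
  shows "emeasure (mixture M t P R) A = ennreal t * emeasure P A + ennreal (1 - t) * emeasure R A"
proof (rule emeasure_measure_of[OF mixture_def])
  show "countably_additive (sets (mixture M t P R))
          (\<lambda>A. ennreal t * emeasure P A + ennreal (1 - t) * emeasure R A)"
  proof (rule countably_additiveI)
    fix B :: "nat \<Rightarrow> 'a set"
    assume B: "range B \<subseteq> sets (mixture M t P R)" "disjoint_family B"
    then have "(\<Sum>i. emeasure P (B i)) = emeasure P (\<Union>i. B i)"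
      and "(\<Sum>i. emeasure R (B i)) = emeasure R (\<Union>i. B i)"
      using assms by (auto intro!: suminf_emeasure)
    then show "(\<Sum>i. ennreal t * emeasure P (B i) + ennreal (1 - t) * emeasure R (B i)) =
        ennreal t * emeasure P (\<Union>i. B i) + ennreal (1 - t) * emeasure R (\<Union>i. B i)"
      by (simp add: suminf_add[symmetric] ennreal_suminf_cmult)
  qed
qed (use assms in \<open>auto simp: positive_def dest: sets.sets_into_space\<close>)

definition convex_measures :: "'a measure \<Rightarrow> 'a measure set \<Rightarrow> bool" where
  "convex_measures M C \<longleftrightarrow> (\<forall>P\<in>C. \<forall>R\<in>C. \<forall>t\<in>{0..1}. mixture M t P R \<in> C)"

text \<open>Note the library's argument order: \<open>absolutely_continuous P R\<close> means that
  \<open>R\<close> is absolutely continuous with respect to \<open>P\<close>.\<close>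

definition dominated_by :: "'a measure set \<Rightarrow> 'a measure set \<Rightarrow> bool" (infix "\<lless>" 50) where
  "\<R> \<lless> \<P> \<longleftrightarrow> (\<forall>R\<in>\<R>. \<exists>P\<in>\<P>. absolutely_continuous P R)"

section \<open>Quasi-sure notions\<close>

definition polar :: "'a measure \<Rightarrow> 'a measure set \<Rightarrow> 'a set \<Rightarrow> bool" where
  "polar M \<P> N \<longleftrightarrow> (\<exists>A\<in>sets M. N \<subseteq> A \<and> (\<forall>P\<in>\<P>. measure P A = 0))"

definition quasi_surely :: "'a measure \<Rightarrow> 'a measure set \<Rightarrow> ('a \<Rightarrow> bool) \<Rightarrow> bool" where
  "quasi_surely M \<P> \<phi> \<longleftrightarrow> (\<exists>N. polar M \<P> N \<and> (\<forall>\<omega>\<in>space M - N. \<phi> \<omega>))"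

definition calL_infty :: "'a measure \<Rightarrow> 'a measure set \<Rightarrow> ('a \<Rightarrow> real) set" where
  "calL_infty M \<P> =
     {X \<in> borel_measurable M. \<exists>K. quasi_surely M \<P> (\<lambda>\<omega>. \<bar>X \<omega>\<bar> \<le> K)}"

definition qs_null :: "'a measure \<Rightarrow> 'a measure set \<Rightarrow> ('a \<Rightarrow> real) set" where
  "qs_null M \<P> = {X \<in> borel_measurable M. quasi_surely M \<P> (\<lambda>\<omega>. X \<omega> = 0)}"

definition L_infty :: "'a measure \<Rightarrow> 'a measure set \<Rightarrow> ('a \<Rightarrow> real) set set" where
  "L_infty M \<P> = calL_infty M \<P> //
     {(X, Y). X \<in> calL_infty M \<P> \<and> Y \<in> calL_infty M \<P> \<and> (\<lambda>\<omega>. X \<omega> - Y \<omega>) \<in> qs_null M \<P>}"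

section \<open>Finite signed measures\<close>

text \<open>Signed measures are set functions, fixed to be 0 off the \<open>\<sigma>\<close>-algebra so that equality
  of signed measures is equality of functions.\<close>

definition finite_signed_measure :: "'a measure \<Rightarrow> ('a set \<Rightarrow> real) \<Rightarrow> bool" where
  "finite_signed_measure M \<mu> \<longleftrightarrow>
     (\<forall>A. A \<notin> sets M \<longrightarrow> \<mu> A = 0) \<and> \<mu> {} = 0 \<and>
     (\<forall>A :: nat \<Rightarrow> 'a set. range A \<subseteq> sets M \<longrightarrow> disjoint_family A \<longrightarrow>
        (\<lambda>i. \<mu> (A i)) sums \<mu> (\<Union>i. A i))"

text \<open>The Jordan decomposition \<open>\<mu> = \<mu>\<^sup>+ - \<mu>\<^sup>-\<close>: here \<open>\<mu>\<^sup>+(A) = sup {\<mu>(B) | B \<subseteq> A measurable}\<close>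
  and \<open>\<mu>\<^sup>- = (-\<mu>)\<^sup>+\<close>. For a finite signed measure these suprema are finite.\<close>

definition pos_variation :: "'a measure \<Rightarrow> ('a set \<Rightarrow> real) \<Rightarrow> 'a set \<Rightarrow> real" where
  "pos_variation M \<mu> A = (SUP B\<in>{B \<in> sets M. B \<subseteq> A}. \<mu> B)"

definition neg_variation :: "'a measure \<Rightarrow> ('a set \<Rightarrow> real) \<Rightarrow> 'a set \<Rightarrow> real" where
  "neg_variation M \<mu> = pos_variation M (\<lambda>A. - \<mu> A)"

text \<open>\<open>\<bar>\<mu>\<bar>(\<Omega>)\<close> with \<open>\<bar>\<mu>\<bar> = \<mu>\<^sup>+ + \<mu>\<^sup>-\<close>.\<close>

definition tv_norm :: "'a measure \<Rightarrow> ('a set \<Rightarrow> real) \<Rightarrow> real" where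
  "tv_norm M \<mu> = pos_variation M \<mu> (space M) + neg_variation M \<mu> (space M)"

definition signed_integral :: "'a measure \<Rightarrow> ('a set \<Rightarrow> real) \<Rightarrow> ('a \<Rightarrow> real) \<Rightarrow> real" where
  "signed_integral M \<mu> h =
     integral\<^sup>L (measure_of (space M) (sets M) (\<lambda>A. ennreal (pos_variation M \<mu> A))) h -
     integral\<^sup>L (measure_of (space M) (sets M) (\<lambda>A. ennreal (neg_variation M \<mu> A))) h"

section \<open>The space \<open>E\<close>, its dual, and the map \<open>l\<close>\<close>

definition space_E :: "'a measure \<Rightarrow> 'a measure set \<Rightarrow> ('a set \<Rightarrow> real) set" where
  "space_E M \<P> =
     {\<mu>. finite_signed_measure M \<mu> \<and> (\<exists>P\<in>\<P>. \<forall>A\<in>null_sets P. \<mu> A = 0)}"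

text \<open>Functionals live on the carrier \<open>space_E M \<P>\<close>; they are made extensional so that equality of
  functionals is equality of functions. When \<open>\<P>\<close> is non-empty and convex, the carrier is a vector
  space under the pointwise operations.\<close>

definition dual_E :: "'a measure \<Rightarrow> 'a measure set \<Rightarrow> (('a set \<Rightarrow> real) \<Rightarrow> real) set" where
  "dual_E M \<P> =
     {\<phi> \<in> extensional (space_E M \<P>).
        (\<forall>\<mu>\<in>space_E M \<P>. \<forall>\<nu>\<in>space_E M \<P>. \<phi> (\<lambda>A. \<mu> A + \<nu> A) = \<phi> \<mu> + \<phi> \<nu>) \<and>
        (\<forall>c. \<forall>\<mu>\<in>space_E M \<P>. \<phi> (\<lambda>A. c * \<mu> A) = c * \<phi> \<mu>) \<and>
        (\<forall>\<mu>\<in>space_E M \<P>. \<forall>e>0. \<exists>d>0. \<forall>\<nu>\<in>space_E M \<P>.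
           tv_norm M (\<lambda>A. \<nu> A - \<mu> A) < d \<longrightarrow> \<bar>\<phi> \<nu> - \<phi> \<mu>\<bar> < e)}"

definition l_rep ::
  "'a measure \<Rightarrow> 'a measure set \<Rightarrow> ('a \<Rightarrow> real) \<Rightarrow> ('a set \<Rightarrow> real) \<Rightarrow> real" where
  "l_rep M \<P> h = (\<lambda>\<mu>\<in>space_E M \<P>. signed_integral M \<mu> h)"

text \<open>On an equivalence class, \<open>l\<close> is the common value of \<open>l_rep\<close> on its representatives.\<close>

definition l_map ::
  "'a measure \<Rightarrow> 'a measure set \<Rightarrow> ('a \<Rightarrow> real) set \<Rightarrow> ('a set \<Rightarrow> real) \<Rightarrow> real" where
  "l_map M \<P> c = the_elem (l_rep M \<P> ` c)"

end

theory Submission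
  imports Defs
begin

text \<open>
  Fix \<open>P\<close> and suppose that every \<open>Q \<in> \<Q>\<close> admits a set \<open>A\<close> with \<open>P(A) < \<epsilon>\<delta>\<close> and \<open>Q(A) \<ge> 2\<epsilon>\<close>.
  The functionals \<open>\<phi>\<close> on \<open>E\<close> that behave like \<open>[0, 1]\<close>-valued functions and satisfy
  \<open>\<phi>(P) \<le> \<epsilon>\<delta>\<close> form a convex weak* compact set (Banach--Alaoglu, i.e. Tychonoff), which contains
  \<open>\<mu> \<mapsto> \<mu>(A)\<close> for each such \<open>A\<close>. By minimax, some \<open>\<phi>\<close> in it satisfies \<open>\<phi>(Q) \<ge> 2\<epsilon>\<close> for all
  \<open>Q \<in> \<Q>\<close> at once. Since \<open>l\<close> is onto \<open>E'\<close>, this \<open>\<phi>\<close> is integration of some \<open>X\<close> with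
  \<open>0 \<le> X \<le> 1\<close>. By the Markov inequality \<open>P(X > \<epsilon>) < \<delta>\<close>, so \<open>Q(X > \<epsilon>) < \<epsilon>\<close> for some \<open>Q\<close>, whence
  \<open>\<phi>(Q) \<le> \<epsilon> + Q(X > \<epsilon>) < 2\<epsilon>\<close>, a contradiction.
\<close>

section \<open>A minimax principle\<close>

text \<open>Otherwise a hyperplane with normal \<open>(u, v)\<close> strictly separates the compact
  set \<open>S\<close> from the closed quadrant. The quadrant is unbounded upwards in both
  coordinates, which forces \<open>u\<close> and \<open>v\<close> to be nonnegative; divided by
  \<open>u + v\<close> they become weights \<open>t\<close> and \<open>1 - t\<close> at which
  \<open>hit\<close> fails.\<close>

lemma compact_convex_meets_quadrant:
  fixes S :: "(real \<times> real) set"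
  assumes "compact S" "convex S"
    and hit: "\<And>t. t \<in> {0..1} \<Longrightarrow> \<exists>(x, y)\<in>S. c \<le> t * x + (1 - t) * y"
  shows "\<exists>(x, y)\<in>S. c \<le> x \<and> c \<le> y"
proof (rule ccontr)
  assume contra: "\<not> (\<exists>(x, y)\<in>S. c \<le> x \<and> c \<le> y)"
  let ?T = "{c..} \<times> {c..}"
  have "S \<noteq> {}"
    using hit[of 0] by auto
  moreover have "S \<inter> ?T = {}"
    using contra by auto
  moreover have "closed ?T" "convex ?T"
    by (simp_all add: closed_Times convex_Times)
  ultimately have "\<exists>a b. (\<forall>x\<in>S. inner a x < b) \<and> (\<forall>x\<in>?T. inner a x > b)"
    using assms(1,2) by (intro separating_hyperplane_compact_closed)
  then obtain a b
    where S: "\<And>x. x \<in> S \<Longrightarrow> inner a x < b" and T: "\<And>x. x \<in> ?T \<Longrightarrow> inner a x > b"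
    by blast
  obtain u v where a: "a = (u, v)"
    by (cases a)
  have T': "u * x + v * y > b" if "c \<le> x" "c \<le> y" for x y
    using T[of "(x, y)"] that by (simp add: a inner_prod_def)
  have S': "u * x + v * y < b" if "(x, y) \<in> S" for x y
    using S[OF that] by (simp add: a inner_prod_def)
  have "u \<ge> 0"
  proof (rule ccontr)
    assume "\<not> u \<ge> 0"
    \<comment> \<open>A shift by \<open>s\<close> along the first axis stays in the quadrant and
      lowers the linear form by exactly \<open>\<bar>u * c + v * c - b\<bar>\<close>, so its value
      there is at most \<open>b\<close>.\<close>
    define s where "s = \<bar>u * c + v * c - b\<bar> / - u"
    have "0 \<le> s" "u * s = - \<bar>u * c + v * c - b\<bar>"
      using \<open>\<not> u \<ge> 0\<close> by (auto simp: s_def divide_nonneg_neg)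
    with T'[of "c + s" c] show False
      by (simp add: distrib_left)
  qed
  moreover have "v \<ge> 0"
  proof (rule ccontr)
    assume "\<not> v \<ge> 0"
    define s where "s = \<bar>u * c + v * c - b\<bar> / - v"
    have "0 \<le> s" "v * s = - \<bar>u * c + v * c - b\<bar>"
      using \<open>\<not> v \<ge> 0\<close> by (auto simp: s_def divide_nonneg_neg)
    with T'[of c "c + s"] show False
      by (simp add: distrib_left)
  qed
  \<comment> \<open>With a zero normal, a point of \<open>S\<close> would give \<open>0 < b\<close>
    and a point of the quadrant \<open>b < 0\<close>.\<close>
  moreover have "u + v \<noteq> 0"
  proof
    assume "u + v = 0"
    with \<open>u \<ge> 0\<close> \<open>v \<ge> 0\<close> have "u = 0" "v = 0"
      by auto
    moreover obtain x y where "(x, y) \<in> S"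
      using \<open>S \<noteq> {}\<close> by auto
    ultimately show False
      using S' T'[of c c] by fastforce
  qed
  ultimately have uv: "u \<ge> 0" "v \<ge> 0" "u + v > 0"
    by auto
  define t where "t = u / (u + v)"
  have "t \<in> {0..1}"
    using uv by (auto simp: t_def field_simps)
  then obtain x y where xy: "(x, y) \<in> S" "c \<le> t * x + (1 - t) * y"
    using hit by blast
  have "(u + v) * c \<le> (u + v) * (t * x + (1 - t) * y)"
    using xy uv by (intro mult_left_mono) auto
  also have "\<dots> = ((u + v) * t) * x + ((u + v) - (u + v) * t) * y"
    by (simp add: algebra_simps)
  also have "(u + v) * t = u"
    using uv by (simp add: t_def)
  finally show False
    using S'[OF xy(1)] T'[of c c] by (simp add: algebra_simps)
qed

lemma closed_coordinate_ge: "closed {\<phi> :: 'i \<Rightarrow> real. c \<le> \<phi> q}"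
  by (intro closed_Collect_le continuous_on_const continuous_on_product_coordinates)

text \<open>Only two coordinates matter, and the map onto them is linear and continuous, so the
  image of \<open>K\<close> is a compact convex subset of the plane.\<close>

lemma compact_convex_meets_halfspace_pair:
  fixes K :: "('i \<Rightarrow> real) set"
  assumes "compact K"
    and conv: "\<And>\<phi> \<psi> t. \<phi> \<in> K \<Longrightarrow> \<psi> \<in> K \<Longrightarrow> t \<in> {0..1} \<Longrightarrow> (\<lambda>i. t * \<phi> i + (1 - t) * \<psi> i) \<in> K"
    and hit: "\<And>t. t \<in> {0..1} \<Longrightarrow> \<exists>\<phi>\<in>K. c \<le> t * \<phi> q + (1 - t) * \<phi> r"
  shows "\<exists>\<phi>\<in>K. c \<le> \<phi> q \<and> c \<le> \<phi> r"
proof -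
  let ?f = "\<lambda>\<phi> :: 'i \<Rightarrow> real. (\<phi> q, \<phi> r)"
  have "compact (?f ` K)"
    using \<open>compact K\<close>
    by (intro compact_continuous_image continuous_on_Pair
        continuous_on_subset[OF continuous_on_product_coordinates]) auto
  moreover have "convex (?f ` K)"
  proof (rule convexI)
    fix x y and u v :: real
    assume *: "x \<in> ?f ` K" "y \<in> ?f ` K" "0 \<le> u" "0 \<le> v" "u + v = 1"
    then obtain \<phi> \<psi> where "\<phi> \<in> K" "\<psi> \<in> K" "x = ?f \<phi>" "y = ?f \<psi>"
      by auto
    then show "u *\<^sub>R x + v *\<^sub>R y \<in> ?f ` K"
      using conv[of \<phi> \<psi> u] * by (intro image_eqI[where x = "\<lambda>i. u * \<phi> i + (1 - u) * \<psi> i"]) auto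
  qed
  moreover have "\<exists>(x, y)\<in>?f ` K. c \<le> t * x + (1 - t) * y" if "t \<in> {0..1}" for t
    using hit[OF that] by auto
  ultimately show ?thesis
    using compact_convex_meets_quadrant[of "?f ` K" c] by auto
qed

text \<open>Kneser's argument: cutting \<open>K\<close> down by one half-space preserves all hypotheses, so the
  finite intersection property follows by induction from the two-dimensional case.\<close>

lemma minimax_finite:
  fixes K :: "('i \<Rightarrow> real) set"
  assumes "finite F" "F \<subseteq> T" "T \<noteq> {}" "compact K"
    and "\<And>\<phi> \<psi> t. \<phi> \<in> K \<Longrightarrow> \<psi> \<in> K \<Longrightarrow> t \<in> {0..1} \<Longrightarrow> (\<lambda>i. t * \<phi> i + (1 - t) * \<psi> i) \<in> K"
    and "\<And>q r t. q \<in> T \<Longrightarrow> r \<in> T \<Longrightarrow> t \<in> {0..1} \<Longrightarrow>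
      \<exists>s\<in>T. \<forall>\<phi>\<in>K. \<phi> s = t * \<phi> q + (1 - t) * \<phi> r"
    and "\<And>q. q \<in> T \<Longrightarrow> \<exists>\<phi>\<in>K. c \<le> \<phi> q"
  shows "\<exists>\<phi>\<in>K. \<forall>q\<in>F. c \<le> \<phi> q"
  using assms
proof (induction F arbitrary: K rule: finite_induct)
  case empty
  \<comment> \<open>Only a point of \<open>K\<close> is required, and any member of the non-empty
    \<open>T\<close> provides one.\<close>
  then show ?case by fast
next
  case (insert q F)
  let ?K = "K \<inter> {\<phi>. c \<le> \<phi> q}"
  have "\<exists>\<phi>\<in>?K. \<forall>r\<in>F. c \<le> \<phi> r"
  proof (rule insert.IH)
    show "compact ?K"
      using insert.prems by (intro compact_Int_closed closed_coordinate_ge)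
    show "(\<lambda>i. t * \<phi> i + (1 - t) * \<psi> i) \<in> ?K" if "\<phi> \<in> ?K" "\<psi> \<in> ?K" "t \<in> {0..1}" for \<phi> \<psi> t
    proof -
      have "t * c + (1 - t) * c \<le> t * \<phi> q + (1 - t) * \<psi> q"
        using that by (intro add_mono mult_left_mono) auto
      then show ?thesis
        using insert.prems(4)[of \<phi> \<psi> t] that by (simp add: algebra_simps)
    qed
    show "\<exists>s\<in>T. \<forall>\<phi>\<in>?K. \<phi> s = t * \<phi> r + (1 - t) * \<phi> r'"
      if "r \<in> T" "r' \<in> T" "t \<in> {0..1}" for r r' t
      using insert.prems(5)[OF that] by blast
    show "\<exists>\<phi>\<in>?K. c \<le> \<phi> r" if "r \<in> T" for r
    proof -
      \<comment> \<open>On \<open>K\<close> the weighted sum is the value at a single index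
        \<open>s\<close> of \<open>T\<close>, where the bound \<open>c\<close> is reached by
        hypothesis.\<close>
      have "\<exists>\<phi>\<in>K. c \<le> t * \<phi> q + (1 - t) * \<phi> r" if t: "t \<in> {0..1}" for t
      proof -
        obtain s where s: "s \<in> T" "\<forall>\<phi>\<in>K. \<phi> s = t * \<phi> q + (1 - t) * \<phi> r"
          using insert.prems(1) insert.prems(5)[OF _ \<open>r \<in> T\<close> t] by blast
        then show ?thesis
          using insert.prems(6)[OF s(1)] by metis
      qed
      then have "\<exists>\<phi>\<in>K. c \<le> \<phi> q \<and> c \<le> \<phi> r"
        by (intro compact_convex_meets_halfspace_pair insert.prems(3,4))
      then show ?thesis
        by blast
    qed
  qed (use insert.prems in auto)
  then show ?case
    by auto
qed

text \<open>The half-spaces are closed in the product topology, so the finite intersection property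
  extends the finite case to all of \<open>T\<close>.\<close>

lemma minimax:
  fixes K :: "('i \<Rightarrow> real) set"
  assumes "T \<noteq> {}" "compact K"
    and "\<And>\<phi> \<psi> t. \<phi> \<in> K \<Longrightarrow> \<psi> \<in> K \<Longrightarrow> t \<in> {0..1} \<Longrightarrow> (\<lambda>i. t * \<phi> i + (1 - t) * \<psi> i) \<in> K"
    and "\<And>q r t. q \<in> T \<Longrightarrow> r \<in> T \<Longrightarrow> t \<in> {0..1} \<Longrightarrow>
      \<exists>s\<in>T. \<forall>\<phi>\<in>K. \<phi> s = t * \<phi> q + (1 - t) * \<phi> r"
    and "\<And>q. q \<in> T \<Longrightarrow> \<exists>\<phi>\<in>K. c \<le> \<phi> q"
  shows "\<exists>\<phi>\<in>K. \<forall>q\<in>T. c \<le> \<phi> q"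
proof -
  have "K \<inter> (\<Inter>q\<in>T. {\<phi>. c \<le> \<phi> q}) \<noteq> {}"
  proof (rule compact_imp_fip_image[OF \<open>compact K\<close> closed_coordinate_ge])
    fix F assume "finite F" "F \<subseteq> T"
    then have "\<exists>\<phi>\<in>K. \<forall>q\<in>F. c \<le> \<phi> q"
      using assms by (rule minimax_finite)
    then show "K \<inter> (\<Inter>q\<in>F. {\<phi>. c \<le> \<phi> q}) \<noteq> {}"
      by blast
  qed
  then show ?thesis
    by blast
qed

section \<open>Finite signed measures\<close>

lemma finite_signed_measure_empty: "finite_signed_measure M \<mu> \<Longrightarrow> \<mu> {} = 0"
  by (simp add: finite_signed_measure_def)

lemma finite_signed_measure_sums:
  "finite_signed_measure M \<mu> \<Longrightarrow> range A \<subseteq> sets M \<Longrightarrow> disjoint_family (A :: nat \<Rightarrow> _) \<Longrightarrow>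
    (\<lambda>i. \<mu> (A i)) sums \<mu> (\<Union>i. A i)"
  by (simp add: finite_signed_measure_def)

lemma finite_signed_measure_Un:
  assumes \<mu>: "finite_signed_measure M \<mu>" and "A \<in> sets M" "B \<in> sets M" "A \<inter> B = {}"
  shows "\<mu> (A \<union> B) = \<mu> A + \<mu> B"
proof -
  have "(\<lambda>i. \<mu> (binaryset A B i)) sums \<mu> (\<Union>i. binaryset A B i)"
    using assms
    by (intro finite_signed_measure_sums[OF \<mu>])
       (auto simp: binaryset_def disjoint_family_on_def)
  moreover have "(\<lambda>i. \<mu> (binaryset A B i)) sums (\<mu> A + \<mu> B)"
    using binaryset_sums[of \<mu> A B] finite_signed_measure_empty[OF \<mu>] by simp
  ultimately show ?thesis
    using sums_unique2 by (fastforce simp: UN_binaryset_eq)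
qed

lemma finite_signed_measure_add:
  assumes "finite_signed_measure M \<mu>" "finite_signed_measure M \<nu>"
  shows "finite_signed_measure M (\<lambda>A. \<mu> A + \<nu> A)"
  using assms by (auto simp: finite_signed_measure_def intro!: sums_add)

lemma finite_signed_measure_scale:
  assumes "finite_signed_measure M \<mu>"
  shows "finite_signed_measure M (\<lambda>A. c * \<mu> A)"
  using assms by (auto simp: finite_signed_measure_def intro!: sums_mult)

text \<open>If the values on measurable subsets of \<open>A\<close> were unbounded, one could split off successively
  disjoint pieces of absolute value at least 1, always keeping a remainder on which the values are
  still unbounded; this contradicts summability.\<close>

lemma finite_signed_measure_bounded:
  assumes \<mu>: "finite_signed_measure M \<mu>"
  shows "\<exists>C. \<forall>A\<in>sets M. \<bar>\<mu> A\<bar> \<le> C"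
proof (rule ccontr)
  define bad where "bad A \<longleftrightarrow> A \<in> sets M \<and> (\<forall>C. \<exists>B\<in>sets M. B \<subseteq> A \<and> C < \<bar>\<mu> B\<bar>)" for A
  assume "\<not> ?thesis"
  then have bad_space: "bad (space M)"
    unfolding bad_def by (metis linorder_not_le sets.sets_into_space sets.top)
  have split: "\<exists>A'. bad A' \<and> A' \<subseteq> A \<and> 1 \<le> \<bar>\<mu> (A - A')\<bar>" if "bad A" for A
  proof -
    have A: "A \<in> sets M"
      using that by (simp add: bad_def)
    \<comment> \<open>The surplus \<bar>\<mu>(A)\<bar> ensures that \<mu>(A - B), too, has absolute
      value at least 1. Hence whichever of \<open>B\<close> and \<open>A - B\<close> stays bad, the
      other one can be split off.\<close>
    have "\<exists>B\<in>sets M. B \<subseteq> A \<and> 1 + \<bar>\<mu> A\<bar> < \<bar>\<mu> B\<bar>"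
      using that unfolding bad_def by simp
    then obtain B where B: "B \<in> sets M" "B \<subseteq> A" "1 + \<bar>\<mu> A\<bar> < \<bar>\<mu> B\<bar>"
      by blast
    have union: "\<mu> C = \<mu> (C \<inter> B) + \<mu> (C - B)" if "C \<in> sets M" for C
      using finite_signed_measure_Un[OF \<mu>, of "C \<inter> B" "C - B"] that B
      by (simp add: Int_Diff_Un Int_Diff_disjoint sets.Int sets.Diff)
    have "A \<inter> B = B"
      using B by blast
    then have diff: "1 \<le> \<bar>\<mu> (A - B)\<bar>"
      using union[OF A] B by simp
    have "bad B \<or> bad (A - B)"
    proof (rule ccontr)
      assume "\<not> (bad B \<or> bad (A - B))"
      then have "\<exists>C1. \<forall>D\<in>sets M. D \<subseteq> B \<longrightarrow> \<bar>\<mu> D\<bar> \<le> C1"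
        and "\<exists>C2. \<forall>D\<in>sets M. D \<subseteq> A - B \<longrightarrow> \<bar>\<mu> D\<bar> \<le> C2"
        using A B(1) by (simp_all add: bad_def not_less)
      then obtain C1 C2
        where C1: "\<And>D. D \<in> sets M \<Longrightarrow> D \<subseteq> B \<Longrightarrow> \<bar>\<mu> D\<bar> \<le> C1"
          and C2: "\<And>D. D \<in> sets M \<Longrightarrow> D \<subseteq> A - B \<Longrightarrow> \<bar>\<mu> D\<bar> \<le> C2"
        by metis
      have "\<exists>D\<in>sets M. D \<subseteq> A \<and> C1 + C2 < \<bar>\<mu> D\<bar>"
        using \<open>bad A\<close> unfolding bad_def by simp
      then obtain D where D: "D \<in> sets M" "D \<subseteq> A" "C1 + C2 < \<bar>\<mu> D\<bar>"
        by blast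
      have "\<bar>\<mu> (D \<inter> B)\<bar> \<le> C1" "\<bar>\<mu> (D - B)\<bar> \<le> C2"
        using D B by (auto intro!: C1 C2)
      with union[OF D(1)] D(3) show False
        by linarith
    qed
    then show ?thesis
    proof
      assume "bad B"
      then show ?thesis
        using B diff by blast
    next
      assume "bad (A - B)"
      moreover have "A - (A - B) = B"
        using B by blast
      ultimately show ?thesis
        using B by (intro exI[of _ "A - B"]) auto
    qed
  qed
  have "\<exists>f :: nat \<Rightarrow> 'a set. \<forall>n. bad (f n) \<and> f (Suc n) \<subseteq> f n \<and> 1 \<le> \<bar>\<mu> (f n - f (Suc n))\<bar>"
    using dependent_nat_choice[of "\<lambda>_. bad" "\<lambda>_ A A'. A' \<subseteq> A \<and> 1 \<le> \<bar>\<mu> (A - A')\<bar>"]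
      split bad_space by metis
  then obtain f :: "nat \<Rightarrow> 'a set"
    where f: "\<And>n. bad (f n)" "\<And>n. f (Suc n) \<subseteq> f n" "\<And>n. 1 \<le> \<bar>\<mu> (f n - f (Suc n))\<bar>"
    by blast
  have dec: "f m \<subseteq> f n" if "n \<le> m" for n m
    using that f(2) by (rule lift_Suc_antimono_le[rotated])
  have "disjoint_family (\<lambda>n. f n - f (Suc n))"
    unfolding disjoint_family_on_def
  proof (intro ballI impI)
    fix m n :: nat assume "m \<noteq> n"
    then consider "Suc m \<le> n" | "Suc n \<le> m" by linarith
    then show "(f m - f (Suc m)) \<inter> (f n - f (Suc n)) = {}"
      by cases (use dec in blast)+
  qed
  moreover have "range (\<lambda>n. f n - f (Suc n)) \<subseteq> sets M"
    using f(1) by (auto simp: bad_def)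
  ultimately have "summable (\<lambda>n. \<mu> (f n - f (Suc n)))"
    using finite_signed_measure_sums[OF \<mu>] sums_summable by blast
  then have "(\<lambda>n. \<mu> (f n - f (Suc n))) \<longlonglongrightarrow> 0"
    by (rule summable_LIMSEQ_zero)
  then have "\<exists>n. norm (\<mu> (f n - f (Suc n))) < 1"
    using LIMSEQ_D[of _ 0 1] by fastforce
  then show False
    using f(3) by (auto simp: not_less[symmetric])
qed

text \<open>Boundedness of \<mu> makes the real-valued \<open>SUP\<close> a genuine upper
  bound.\<close>

lemma le_pos_variation:
  assumes "finite_signed_measure M \<mu>" "B \<in> sets M" "B \<subseteq> A"
  shows "\<mu> B \<le> pos_variation M \<mu> A"
proof -
  obtain C where "\<forall>A\<in>sets M. \<bar>\<mu> A\<bar> \<le> C"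
    using finite_signed_measure_bounded[OF assms(1)] by blast
  then have "bdd_above (\<mu> ` {B \<in> sets M. B \<subseteq> A})"
    by (intro bdd_aboveI2[where M = C]) (auto simp: abs_le_iff)
  then show ?thesis
    unfolding pos_variation_def using assms by (intro cSUP_upper) auto
qed

lemma abs_le_tv_norm:
  assumes \<mu>: "finite_signed_measure M \<mu>" and A: "A \<in> sets M"
  shows "\<bar>\<mu> A\<bar> \<le> tv_norm M \<mu>"
proof -
  have neg: "finite_signed_measure M (\<lambda>A. - \<mu> A)"
    using finite_signed_measure_scale[OF \<mu>, of "-1"] by simp
  have "A \<subseteq> space M"
    using A by (rule sets.sets_into_space)
  then have "\<mu> A \<le> pos_variation M \<mu> (space M)" "- \<mu> A \<le> neg_variation M \<mu> (space M)"
    using le_pos_variation[OF \<mu> A] le_pos_variation[OF neg A] by (auto simp: neg_variation_def)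
  \<comment> \<open>Both suprema range over a family containing the empty set, so neither is
    negative and each is at most their sum.\<close>
  moreover have "0 \<le> pos_variation M \<mu> (space M)" "0 \<le> neg_variation M \<mu> (space M)"
    using le_pos_variation[OF \<mu>, of "{}"] le_pos_variation[OF neg, of "{}"]
    by (auto simp: neg_variation_def finite_signed_measure_empty[OF \<mu>])
  ultimately show ?thesis
    by (simp add: tv_norm_def)
qed

section \<open>Finite positive measures as signed measures\<close>

lemma finite_signed_measure_measure:
  assumes "finite_measure N" "sets N = sets M"
  shows "finite_signed_measure M (measure N)"
  using assms finite_measure.finite_measure_UNION[OF assms(1)]
  by (auto simp: finite_signed_measure_def measure_notin_sets)

lemma pos_variation_measure:
  assumes "finite_measure N" "sets N = sets M" "A \<in> sets M"
  shows "pos_variation M (measure N) A = measure N A"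
  unfolding pos_variation_def using assms
  by (intro cSup_eq_maximum) (auto intro!: finite_measure.finite_measure_mono)

lemma neg_variation_measure:
  "neg_variation M (measure N) A = 0"
  unfolding neg_variation_def pos_variation_def
  by (intro cSup_eq_maximum) (auto intro!: image_eqI[where x = "{}"])

lemma signed_integral_measure:
  assumes N: "finite_measure N" "sets N = sets M"
  shows "signed_integral M (measure N) h = integral\<^sup>L N h"
proof -
  have "measure_of (space M) (sets M) (\<lambda>A. ennreal (pos_variation M (measure N) A)) =
      measure_of (space N) (sets N) (emeasure N)"
    unfolding sets_eq_imp_space_eq[OF N(2)] N(2)
    using N by (intro measure_of_eq sets.space_closed)
      (simp add: pos_variation_measure sets.sigma_sets_eq finite_measure.emeasure_eq_measure)
  \<comment> \<open>The negative variation is identically 0, so the whole space is a null set and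
    every integrand vanishes almost everywhere.\<close>
  moreover have "integral\<^sup>L (measure_of (space M) (sets M)
      (\<lambda>A. ennreal (neg_variation M (measure N) A))) h = 0"
    by (rule integral_eq_zero_AE) (auto simp: neg_variation_measure eventually_ae_filter null_sets_def
        emeasure_measure_of_conv sets.sigma_sets_eq intro!: exI[of _ "space M"])
  ultimately show ?thesis
    by (simp add: signed_integral_def measure_of_of_measure)
qed

text \<open>By \<open>emeasure_measure_of_conv\<close> the value at \<open>A\<close> is either the
  positive variation, which is a supremum of zeros, or the default value 0 of
  \<open>measure_of\<close>; both cases give a null set.\<close>

lemma null_set_variation:
  assumes "A \<in> sets M" "\<And>B. B \<in> sets M \<Longrightarrow> B \<subseteq> A \<Longrightarrow> \<mu> B = 0"
  shows "A \<in> null_sets (measure_of (space M) (sets M) (\<lambda>A. ennreal (pos_variation M \<mu> A)))"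
proof -
  have "pos_variation M \<mu> A = 0"
    unfolding pos_variation_def using assms
    by (intro cSup_eq_maximum) (auto intro!: image_eqI[where x = "{}"])
  then show ?thesis
    using assms by (simp add: null_sets_def emeasure_measure_of_conv)
qed

section \<open>The space \<open>E\<close>\<close>

lemma prob_algebraD:
  assumes "P \<in> space (prob_algebra M)"
  shows "prob_space P" "sets P = sets M" "space P = space M" "finite_measure P"
  using assms by (auto simp: space_prob_algebra prob_space.finite_measure dest: sets_eq_imp_space_eq)

lemma AE_quasi_surely:
  assumes "quasi_surely M \<P> \<phi>" "P \<in> \<P>" "\<P> \<subseteq> space (prob_algebra M)"
  shows "AE \<omega> in P. \<phi> \<omega>"
proof -
  have P: "P \<in> space (prob_algebra M)"
    using assms by blast
  interpret prob_space P
    by (rule prob_algebraD[OF P])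
  obtain N A where *: "A \<in> sets M" "N \<subseteq> A" "measure P A = 0" "\<forall>\<omega>\<in>space M - N. \<phi> \<omega>"
    using assms unfolding quasi_surely_def polar_def by blast
  show ?thesis
  proof (rule AE_I')
    show "A \<in> null_sets P"
      using * prob_algebraD[OF P] by (simp add: null_sets_def emeasure_eq_measure)
    show "{\<omega> \<in> space P. \<not> \<phi> \<omega>} \<subseteq> A"
      using * prob_algebraD[OF P] by blast
  qed
qed

text \<open>For \<open>A\<close> outside the \<sigma>-algebra both sides are 0, so the identity is
  one of set functions, to which functionals on \<open>E\<close> can be applied.\<close>

lemma measure_mixture:
  assumes "P \<in> space (prob_algebra M)" "R \<in> space (prob_algebra M)" "t \<in> {0..1}"
  shows "measure (mixture M t P R) A = t * measure P A + (1 - t) * measure R A"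
proof (cases "A \<in> sets M")
  case True
  have "emeasure (mixture M t P R) A =
      ennreal (t * measure P A + (1 - t) * measure R A)"
    using assms True
    by (simp add: emeasure_mixture prob_algebraD finite_measure.emeasure_eq_measure
        ennreal_mult'[symmetric] ennreal_plus[symmetric] del: ennreal_plus)
  then show ?thesis
    using assms(3) by (simp add: measure_eq_emeasure_eq_ennreal)
next
  case False
  then show ?thesis
    using assms by (simp add: measure_notin_sets prob_algebraD)
qed

text \<open>Convexity of \<P> provides a common dominating measure: a null set of the equal-weight
  mixture is null for both \<open>P\<close> and \<open>R\<close>.\<close>

lemma space_E_add:
  assumes \<P>: "\<P> \<subseteq> space (prob_algebra M)" "convex_measures M \<P>"
    and "\<mu> \<in> space_E M \<P>" "\<nu> \<in> space_E M \<P>"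
  shows "(\<lambda>A. \<mu> A + \<nu> A) \<in> space_E M \<P>"
proof -
  obtain P R where PR: "P \<in> \<P>" "R \<in> \<P>" "\<forall>A\<in>null_sets P. \<mu> A = 0" "\<forall>A\<in>null_sets R. \<nu> A = 0"
    using assms unfolding space_E_def by blast
  have S: "mixture M (1/2) P R \<in> \<P>"
    using \<P>(2) PR unfolding convex_measures_def by simp
  have "sets P = sets M" "sets R = sets M"
    using PR \<P>(1) prob_algebraD(2) by blast+
  then have "A \<in> null_sets P \<inter> null_sets R" if "A \<in> null_sets (mixture M (1/2) P R)" for A
    using that by (auto simp: null_sets_def emeasure_mixture ennreal_eq_0_iff)
  then have "\<forall>A\<in>null_sets (mixture M (1/2) P R). \<mu> A + \<nu> A = 0"
    using PR by auto
  then show ?thesis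
    using assms S by (auto simp: space_E_def finite_signed_measure_add)
qed

lemma space_E_scale: "\<mu> \<in> space_E M \<P> \<Longrightarrow> (\<lambda>A. c * \<mu> A) \<in> space_E M \<P>"
  by (auto simp: space_E_def finite_signed_measure_scale)

lemma measure_in_space_E:
  assumes "finite_measure N" "sets N = sets M" "P \<in> \<P>" "absolutely_continuous P N"
  shows "measure N \<in> space_E M \<P>"
proof -
  have "\<forall>A\<in>null_sets P. measure N A = 0"
    using assms(4) by (auto simp: absolutely_continuous_def measure_eq_0_null_sets)
  then show ?thesis
    using assms(1-3) finite_signed_measure_measure by (auto simp: space_E_def)
qed

section \<open>Well-definedness of \<open>l\<close> on equivalence classes\<close>

lemma signed_integral_cong:
  assumes "X \<in> borel_measurable M" "Y \<in> borel_measurable M"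
    and qs: "quasi_surely M \<P> (\<lambda>\<omega>. X \<omega> - Y \<omega> = 0)"
    and \<P>: "\<P> \<subseteq> space (prob_algebra M)" and \<mu>: "\<mu> \<in> space_E M \<P>"
  shows "signed_integral M \<mu> X = signed_integral M \<mu> Y"
proof -
  obtain P where P: "P \<in> \<P>" "\<forall>A\<in>null_sets P. \<mu> A = 0"
    using \<mu> unfolding space_E_def by blast
  have "AE \<omega> in P. X \<omega> - Y \<omega> = 0"
    using qs P(1) \<P> by (rule AE_quasi_surely)
  then obtain N where N: "N \<in> null_sets P" "{\<omega> \<in> space P. X \<omega> - Y \<omega> \<noteq> 0} \<subseteq> N"
    by (auto simp: eventually_ae_filter)
  have PM: "sets P = sets M" "space P = space M"
    using P \<P> prob_algebraD by blast+
  \<comment> \<open>Stated for a general \<nu> so that it serves both \<mu> and its negative. All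
    measurable subsets of the \<open>P\<close>-null set \<open>N\<close> are \<open>P\<close>-null,
    so the variation of \<nu> vanishes on \<open>N\<close>.\<close>
  have *: "integral\<^sup>L (measure_of (space M) (sets M) (\<lambda>A. ennreal (pos_variation M \<nu> A))) X =
      integral\<^sup>L (measure_of (space M) (sets M) (\<lambda>A. ennreal (pos_variation M \<nu> A))) Y"
    if "\<forall>A\<in>null_sets P. \<nu> A = 0" for \<nu>
  proof (rule integral_cong_AE)
    have "N \<in> null_sets (measure_of (space M) (sets M) (\<lambda>A. ennreal (pos_variation M \<nu> A)))"
      using N(1) that PM null_sets_subset[OF N(1)]
      by (intro null_set_variation) (auto simp: null_sets_def)
    moreover have "{\<omega> \<in> space M. X \<omega> \<noteq> Y \<omega>} \<subseteq> N"
      using N(2) PM by auto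
    ultimately show "AE \<omega> in measure_of (space M) (sets M) (\<lambda>A. ennreal (pos_variation M \<nu> A)).
        X \<omega> = Y \<omega>"
      by (intro AE_I') (auto simp: space_measure_of_conv)
  qed (use assms(1,2) in \<open>auto cong: measurable_cong_sets\<close>)
  show ?thesis
    unfolding signed_integral_def neg_variation_def using P(2)
    by (auto intro!: arg_cong2[where f = minus] *)
qed

text \<open>Since \<open>l_rep\<close> is constant on a class, \<open>the_elem\<close> picks its
  value at any representative; this lets surjectivity of \<open>l\<close> be used through actual
  functions.\<close>

lemma l_map_representative:
  assumes \<P>: "\<P> \<subseteq> space (prob_algebra M)" and c: "c \<in> L_infty M \<P>"
  obtains X where "X \<in> calL_infty M \<P>" "l_map M \<P> c = l_rep M \<P> X"
proof -
  obtain X where X: "X \<in> calL_infty M \<P>"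
    and c: "c = {Y. Y \<in> calL_infty M \<P> \<and> (\<lambda>\<omega>. X \<omega> - Y \<omega>) \<in> qs_null M \<P>}"
    using c unfolding L_infty_def by (auto elim!: quotientE)
  have const: "l_rep M \<P> Y = l_rep M \<P> X" if "Y \<in> c" for Y
    unfolding l_rep_def
  proof (rule restrict_ext)
    fix \<mu> assume "\<mu> \<in> space_E M \<P>"
    then show "signed_integral M \<mu> Y = signed_integral M \<mu> X"
      using that X \<P> unfolding c
      by (intro signed_integral_cong[symmetric]) (auto simp: calL_infty_def qs_null_def)
  qed
  have "X \<in> c"
    using X by (auto simp: c qs_null_def quasi_surely_def polar_def
        intro!: exI[of _ "{}"] bexI[of _ "{}"])
  then have "c \<noteq> {}"
    by blast
  then have "l_map M \<P> c = l_rep M \<P> X"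
    unfolding l_map_def using const by (rule the_elem_image_unique)
  with X show ?thesis
    by (rule that)
qed

section \<open>Test functionals\<close>

text \<open>The functionals that would be represented by functions with values in \<open>[0, 1]\<close>.\<close>

definition test_functionals ::
  "'a measure \<Rightarrow> 'a measure set \<Rightarrow> (('a set \<Rightarrow> real) \<Rightarrow> real) set" where
  "test_functionals M \<P> =
     {\<phi> \<in> extensional (space_E M \<P>).
        (\<forall>\<mu>\<in>space_E M \<P>. \<forall>\<nu>\<in>space_E M \<P>. \<phi> (\<lambda>A. \<mu> A + \<nu> A) = \<phi> \<mu> + \<phi> \<nu>) \<and>
        (\<forall>c. \<forall>\<mu>\<in>space_E M \<P>. \<phi> (\<lambda>A. c * \<mu> A) = c * \<phi> \<mu>) \<and>
        (\<forall>\<mu>\<in>space_E M \<P>. \<bar>\<phi> \<mu>\<bar> \<le> tv_norm M \<mu>) \<and>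
        (\<forall>\<mu>\<in>space_E M \<P>. (\<forall>A. 0 \<le> \<mu> A) \<longrightarrow> 0 \<le> \<phi> \<mu> \<and> \<phi> \<mu> \<le> \<mu> (space M))}"

lemma test_functionals_add:
  "\<phi> \<in> test_functionals M \<P> \<Longrightarrow> \<mu> \<in> space_E M \<P> \<Longrightarrow> \<nu> \<in> space_E M \<P> \<Longrightarrow>
    \<phi> (\<lambda>A. \<mu> A + \<nu> A) = \<phi> \<mu> + \<phi> \<nu>"
  by (simp add: test_functionals_def)

lemma test_functionals_scale:
  "\<phi> \<in> test_functionals M \<P> \<Longrightarrow> \<mu> \<in> space_E M \<P> \<Longrightarrow> \<phi> (\<lambda>A. c * \<mu> A) = c * \<phi> \<mu>"
  by (simp add: test_functionals_def)

text \<open>The total variation bound, applied to a difference, makes \<phi> 1-Lipschitz, so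
  \<open>d = e\<close> serves in the continuity condition.\<close>

lemma test_functionals_subset_dual_E:
  assumes \<P>: "\<P> \<subseteq> space (prob_algebra M)" "convex_measures M \<P>"
  shows "test_functionals M \<P> \<subseteq> dual_E M \<P>"
proof
  fix \<phi> assume \<phi>: "\<phi> \<in> test_functionals M \<P>"
  have "\<bar>\<phi> \<nu> - \<phi> \<mu>\<bar> \<le> tv_norm M (\<lambda>A. \<nu> A - \<mu> A)"
    if "\<mu> \<in> space_E M \<P>" "\<nu> \<in> space_E M \<P>" for \<mu> \<nu>
  proof -
    have neg: "(\<lambda>A. (-1) * \<mu> A) \<in> space_E M \<P>"
      using that(1) by (rule space_E_scale)
    have "(\<lambda>A. \<nu> A + (-1) * \<mu> A) \<in> space_E M \<P>"
      using \<P> that(2) neg by (rule space_E_add)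
    then have "\<bar>\<phi> (\<lambda>A. \<nu> A + (-1) * \<mu> A)\<bar> \<le> tv_norm M (\<lambda>A. \<nu> A + (-1) * \<mu> A)"
      using \<phi> by (simp add: test_functionals_def)
    moreover have "\<phi> (\<lambda>A. \<nu> A + (-1) * \<mu> A) = \<phi> \<nu> + (-1) * \<phi> \<mu>"
      by (simp only: test_functionals_add[OF \<phi> that(2) neg] test_functionals_scale[OF \<phi> that(1)])
    ultimately show ?thesis
      by simp
  qed
  then have "\<forall>\<mu>\<in>space_E M \<P>. \<forall>e>0. \<exists>d>0. \<forall>\<nu>\<in>space_E M \<P>.
      tv_norm M (\<lambda>A. \<nu> A - \<mu> A) < d \<longrightarrow> \<bar>\<phi> \<nu> - \<phi> \<mu>\<bar> < e"
    by (blast intro: le_less_trans)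
  then show "\<phi> \<in> dual_E M \<P>"
    using \<phi> by (simp add: test_functionals_def dual_E_def)
qed

text \<open>The total variation bound confines \<phi> to a product of compact sets, compact by
  Tychonoff. Each remaining condition involves finitely many coordinates and is closed.\<close>

lemma compact_test_functionals: "compact (test_functionals M \<P>)"
proof -
  let ?E = "space_E M \<P>"
  \<comment> \<open>The singleton factors off \<open>E\<close> encode extensionality.\<close>
  let ?B = "\<lambda>\<mu>. if \<mu> \<in> ?E then {- tv_norm M \<mu>..tv_norm M \<mu>} else {undefined}"
  let ?C = "{\<phi>. (\<forall>\<mu>\<in>?E. \<forall>\<nu>\<in>?E. \<phi> (\<lambda>A. \<mu> A + \<nu> A) = \<phi> \<mu> + \<phi> \<nu>) \<and>
        (\<forall>c. \<forall>\<mu>\<in>?E. \<phi> (\<lambda>A. c * \<mu> A) = c * \<phi> \<mu>) \<and>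
        (\<forall>\<mu>\<in>?E. (\<forall>A. 0 \<le> \<mu> A) \<longrightarrow> 0 \<le> \<phi> \<mu> \<and> \<phi> \<mu> \<le> \<mu> (space M))}"
  have "compact (PiE UNIV ?B)"
    using compactin_PiE[of "\<lambda>_. euclidean" UNIV ?B]
    by (simp add: euclidean_product_topology)
  moreover have "closed ?C"
    unfolding Ball_def
    by (intro closed_Collect_conj closed_Collect_all closed_Collect_imp
        closed_Collect_le closed_Collect_eq open_Collect_const continuous_on_const
        continuous_on_add continuous_on_mult continuous_on_product_coordinates)
  moreover have "\<bar>x\<bar> \<le> y \<longleftrightarrow> - y \<le> x \<and> x \<le> y" for x y :: real
    by auto
  then have "test_functionals M \<P> = PiE UNIV ?B \<inter> ?C"
    by (auto simp: test_functionals_def extensional_def PiE_iff split: if_splits)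
  ultimately show ?thesis
    by (simp add: compact_Int_closed)
qed

lemma convex_test_functionals:
  assumes \<phi>: "\<phi> \<in> test_functionals M \<P>" and \<psi>: "\<psi> \<in> test_functionals M \<P>" and t: "t \<in> {0..1}"
  shows "(\<lambda>\<mu>. t * \<phi> \<mu> + (1 - t) * \<psi> \<mu>) \<in> test_functionals M \<P>"
proof -
  have t': "0 \<le> t" "0 \<le> 1 - t"
    using t by auto
  have tv: "\<bar>t * \<phi> \<mu> + (1 - t) * \<psi> \<mu>\<bar> \<le> tv_norm M \<mu>" if "\<mu> \<in> space_E M \<P>" for \<mu>
  proof -
    have "\<bar>t * \<phi> \<mu> + (1 - t) * \<psi> \<mu>\<bar> \<le> t * \<bar>\<phi> \<mu>\<bar> + (1 - t) * \<bar>\<psi> \<mu>\<bar>"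
      using t' by (metis abs_mult abs_of_nonneg abs_triangle_ineq)
    also have "\<dots> \<le> t * tv_norm M \<mu> + (1 - t) * tv_norm M \<mu>"
      using \<phi> \<psi> that t' by (intro add_mono mult_left_mono) (auto simp: test_functionals_def)
    finally show ?thesis
      by (simp add: algebra_simps)
  qed
  have pos: "0 \<le> t * \<phi> \<mu> + (1 - t) * \<psi> \<mu> \<and> t * \<phi> \<mu> + (1 - t) * \<psi> \<mu> \<le> \<mu> (space M)"
    if \<mu>: "\<mu> \<in> space_E M \<P>" "\<forall>A. 0 \<le> \<mu> A" for \<mu>
  proof -
    have "0 \<le> \<phi> \<mu>" "\<phi> \<mu> \<le> \<mu> (space M)" "0 \<le> \<psi> \<mu>" "\<psi> \<mu> \<le> \<mu> (space M)"
      using \<phi> \<psi> \<mu> by (auto simp: test_functionals_def)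
    moreover from this have "t * \<phi> \<mu> + (1 - t) * \<psi> \<mu> \<le> t * \<mu> (space M) + (1 - t) * \<mu> (space M)"
      using t' by (intro add_mono mult_left_mono)
    moreover have "t * \<mu> (space M) + (1 - t) * \<mu> (space M) = \<mu> (space M)"
      by (simp add: algebra_simps)
    ultimately show ?thesis
      using t' by simp
  qed
  \<comment> \<open>Off \<open>E\<close> both functionals take the value \<open>undefined\<close>,
    and a convex combination of a number with itself is that number.\<close>
  have ext: "(\<lambda>\<mu>. t * \<phi> \<mu> + (1 - t) * \<psi> \<mu>) \<in> extensional (space_E M \<P>)"
    using \<phi> \<psi> by (auto simp: test_functionals_def extensional_def algebra_simps)
  show ?thesis
    unfolding test_functionals_def mem_Collect_eq
  proof (intro conjI ext tv pos ballI allI impI)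
    fix \<mu> \<nu> assume "\<mu> \<in> space_E M \<P>" "\<nu> \<in> space_E M \<P>"
    then have "\<phi> (\<lambda>A. \<mu> A + \<nu> A) = \<phi> \<mu> + \<phi> \<nu>" "\<psi> (\<lambda>A. \<mu> A + \<nu> A) = \<psi> \<mu> + \<psi> \<nu>"
      using \<phi> \<psi> by (auto simp: test_functionals_def)
    then show "t * \<phi> (\<lambda>A. \<mu> A + \<nu> A) + (1 - t) * \<psi> (\<lambda>A. \<mu> A + \<nu> A) =
        t * \<phi> \<mu> + (1 - t) * \<psi> \<mu> + (t * \<phi> \<nu> + (1 - t) * \<psi> \<nu>)"
      by (simp add: algebra_simps)
  next
    fix c \<mu> assume "\<mu> \<in> space_E M \<P>"
    then have "\<phi> (\<lambda>A. c * \<mu> A) = c * \<phi> \<mu>" "\<psi> (\<lambda>A. c * \<mu> A) = c * \<psi> \<mu>"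
      using \<phi> \<psi> by (auto simp: test_functionals_def)
    then show "t * \<phi> (\<lambda>A. c * \<mu> A) + (1 - t) * \<psi> (\<lambda>A. c * \<mu> A) = c * (t * \<phi> \<mu> + (1 - t) * \<psi> \<mu>)"
      by (simp add: algebra_simps)
  qed (use tv pos in auto)
qed

text \<open>This is integration of the indicator of \<open>A\<close>; such functionals are the ones
  from which the minimax argument starts.\<close>

lemma evaluation_in_test_functionals:
  assumes \<P>: "\<P> \<subseteq> space (prob_algebra M)" "convex_measures M \<P>" and A: "A \<in> sets M"
  shows "(\<lambda>\<mu>\<in>space_E M \<P>. \<mu> A) \<in> test_functionals M \<P>"
proof -
  have "\<mu> A \<le> \<mu> (space M)" if "\<mu> \<in> space_E M \<P>" "\<forall>A. 0 \<le> \<mu> A" for \<mu>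
  proof -
    have "\<mu> (A \<union> (space M - A)) = \<mu> A + \<mu> (space M - A)"
      using that A by (intro finite_signed_measure_Un[of M]) (auto simp: space_E_def)
    moreover have "A \<union> (space M - A) = space M"
      using sets.sets_into_space[OF A] by blast
    ultimately show ?thesis
      using that by simp
  qed
  moreover have "\<bar>\<mu> A\<bar> \<le> tv_norm M \<mu>" if "\<mu> \<in> space_E M \<P>" for \<mu>
    using that A by (intro abs_le_tv_norm) (simp_all add: space_E_def)
  ultimately show ?thesis
    unfolding test_functionals_def by (simp add: space_E_add[OF \<P>] space_E_scale)
qed

text \<open>The bounds are obtained by testing \<open>X\<close> against the restrictions of \<open>N\<close> to the sets
  \<open>{X < 0}\<close> and \<open>{X > 1}\<close>.\<close>

lemma l_rep_test_functional_bounds: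
  assumes \<P>: "\<P> \<subseteq> space (prob_algebra M)" and X: "X \<in> calL_infty M \<P>"
    and test: "l_rep M \<P> X \<in> test_functionals M \<P>"
    and N: "N \<in> space (prob_algebra M)" "P \<in> \<P>" "absolutely_continuous P N"
  shows "integrable N X" "l_rep M \<P> X (measure N) = integral\<^sup>L N X" "AE \<omega> in N. X \<omega> \<in> {0..1}"
proof -
  interpret N: prob_space N
    by (rule prob_algebraD[OF N(1)])
  have NM: "sets N = sets M" "space N = space M"
    using prob_algebraD[OF N(1)] by auto
  have P: "sets P = sets N"
    using subsetD[OF \<P> N(2)] NM by (simp add: prob_algebraD)
  have [measurable]: "X \<in> borel_measurable N"
    using X NM by (simp add: calL_infty_def cong: measurable_cong_sets)
  obtain K where "quasi_surely M \<P> (\<lambda>\<omega>. \<bar>X \<omega>\<bar> \<le> K)"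
    using X by (auto simp: calL_infty_def)
  then have "AE \<omega> in P. \<bar>X \<omega>\<bar> \<le> K"
    using N(2) \<P> by (rule AE_quasi_surely)
  then have "AE \<omega> in N. \<bar>X \<omega>\<bar> \<le> K"
    using P[symmetric] N(3) by (intro absolutely_continuous_AE[of N P])
  then show int: "integrable N X"
    by (intro N.integrable_const_bound[where B = K]) auto
  have rep: "l_rep M \<P> X (measure \<nu>) = integral\<^sup>L \<nu> X"
    if "finite_measure \<nu>" "sets \<nu> = sets M" "absolutely_continuous P \<nu>" for \<nu>
    using measure_in_space_E[OF that(1,2) N(2) that(3)] signed_integral_measure[OF that(1,2)]
    by (simp add: l_rep_def)
  show "l_rep M \<P> X (measure N) = integral\<^sup>L N X"
    using N NM by (intro rep) unfold_locales
  have restrict: "0 \<le> (\<integral>\<omega>. indicator A \<omega> * X \<omega> \<partial>N)" "(\<integral>\<omega>. indicator A \<omega> * X \<omega> \<partial>N) \<le> measure N A"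
    if A: "A \<in> sets N" for A
  proof -
    let ?\<nu> = "density N (indicator A)"
    have fin: "finite_measure ?\<nu>"
      using A by (rule N.finite_measure_restricted)
    have ac: "absolutely_continuous P ?\<nu>"
      using N(3) absolutely_continuousI_density[of "indicator A" N] A
      by (auto simp: absolutely_continuous_def)
    have "measure ?\<nu> \<in> space_E M \<P>"
      using fin N(2) ac NM by (intro measure_in_space_E) auto
    then have "0 \<le> l_rep M \<P> X (measure ?\<nu>)" "l_rep M \<P> X (measure ?\<nu>) \<le> measure ?\<nu> (space M)"
      using test by (auto simp: test_functionals_def)
    moreover have "measure ?\<nu> (space M) = measure N A"
      using A by (simp add: measure_restricted sets.Int_space_eq2 flip: NM(2))
    moreover have "integral\<^sup>L ?\<nu> X = (\<integral>\<omega>. indicator A \<omega> * X \<omega> \<partial>N)"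
      using integral_density[of X N "indicator A"] A by (simp add: ennreal_indicator)
    ultimately show "0 \<le> (\<integral>\<omega>. indicator A \<omega> * X \<omega> \<partial>N)"
      "(\<integral>\<omega>. indicator A \<omega> * X \<omega> \<partial>N) \<le> measure N A"
      using rep[OF fin _ ac] NM by auto
  qed
  \<comment> \<open>The positive part of \<open>Y\<close> is nonnegative with integral at most 0, so
    it vanishes almost everywhere. The cases \<open>Y = - X\<close> and \<open>Y = X - 1\<close>
    give the two bounds.\<close>
  have AE_le: "AE \<omega> in N. Y \<omega> \<le> 0"
    if Y: "integrable N Y" "(\<integral>\<omega>. indicator {\<omega>\<in>space N. 0 < Y \<omega>} \<omega> * Y \<omega> \<partial>N) \<le> 0"
    for Y :: "'a \<Rightarrow> real"
  proof -
    let ?f = "\<lambda>\<omega>. indicator {\<omega>\<in>space N. 0 < Y \<omega>} \<omega> * Y \<omega>"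
    have [measurable]: "Y \<in> borel_measurable N"
      using Y by auto
    have "integrable N ?f"
      using integrable_mult_indicator[OF _ Y(1), of "{\<omega>\<in>space N. 0 < Y \<omega>}"] by simp
    moreover have nonneg: "0 \<le> ?f \<omega>" for \<omega>
      by (auto simp: indicator_def)
    moreover have "integral\<^sup>L N ?f = 0"
      using Y(2) nonneg by (intro antisym Bochner_Integration.integral_nonneg)
    ultimately have "AE \<omega> in N. ?f \<omega> = 0"
      using integral_nonneg_eq_0_iff_AE[of N ?f] by simp
    then show ?thesis
      by (rule AE_mp) (auto simp: indicator_def)
  qed
  have "AE \<omega> in N. - X \<omega> \<le> 0"
    using int restrict(1)[of "{\<omega>\<in>space N. 0 < - X \<omega>}"] by (intro AE_le) auto
  moreover have "AE \<omega> in N. X \<omega> - 1 \<le> 0"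
  proof (rule AE_le)
    let ?A = "{\<omega>\<in>space N. 0 < X \<omega> - 1}"
    have A: "?A \<in> sets N"
      by measurable
    have "integrable N (\<lambda>\<omega>. indicator ?A \<omega> * X \<omega>)"
      using integrable_mult_indicator[OF A int] by simp
    moreover have "integrable N (indicator ?A :: 'a \<Rightarrow> real)"
      using A by (simp add: N.emeasure_eq_measure)
    ultimately have "(\<integral>\<omega>. indicator ?A \<omega> * (X \<omega> - 1) \<partial>N) =
        (\<integral>\<omega>. indicator ?A \<omega> * X \<omega> \<partial>N) - measure N ?A"
      using A by (simp add: right_diff_distrib Bochner_Integration.integral_diff)
    then show "(\<integral>\<omega>. indicator ?A \<omega> * (X \<omega> - 1) \<partial>N) \<le> 0"
      using restrict(2)[OF A] by simp
  qed (use int in auto)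
  ultimately show "AE \<omega> in N. X \<omega> \<in> {0..1}"
    by eventually_elim auto
qed

section \<open>Uniform separation\<close>

theorem theorem2p4:
  fixes M :: "'a measure" and \<P> \<Q> :: "'a measure set" and \<epsilon> \<delta> :: real
  assumes "\<P> \<subseteq> space (prob_algebra M)" and "\<P> \<noteq> {}" and "convex_measures M \<P>"
    and "\<Q> \<subseteq> space (prob_algebra M)" and "\<Q> \<noteq> {}" and "convex_measures M \<Q>"
    and "\<Q> \<lless> \<P>"
    and "l_map M \<P> ` L_infty M \<P> = dual_E M \<P>"
    and "\<epsilon> > 0" and "\<delta> > 0"
    and "\<forall>A\<in>sets M. (\<exists>P\<in>\<P>. measure P A < \<delta>) \<longrightarrow> (\<exists>Q\<in>\<Q>. measure Q A < \<epsilon>)"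
  shows "\<forall>P\<in>\<P>. \<exists>Q\<in>\<Q>. \<forall>A\<in>sets M. measure P A < \<epsilon> * \<delta> \<longrightarrow> measure Q A < 2 * \<epsilon>"
proof (intro ballI, rule ccontr)
  fix P assume P: "P \<in> \<P>"
  assume contra: "\<not> (\<exists>Q\<in>\<Q>. \<forall>A\<in>sets M. measure P A < \<epsilon> * \<delta> \<longrightarrow> measure Q A < 2 * \<epsilon>)"
  \<comment> \<open>The bound is weakened from < to \<le> to keep \<open>?K\<close> closed;
    strictness is recovered in the estimate of P(A) below.\<close>
  let ?K = "test_functionals M \<P> \<inter> {\<phi>. \<phi> (measure P) \<le> \<epsilon> * \<delta>}"
  have P_in: "P \<in> space (prob_algebra M)"
    using assms(1) P by blast
  interpret P: prob_space P
    by (rule prob_algebraD[OF P_in])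
  have PM: "sets P = sets M" "space P = space M"
    using prob_algebraD[OF P_in] by auto
  have P_ac: "absolutely_continuous P P"
    by (simp add: absolutely_continuous_def)
  have P_E: "measure P \<in> space_E M \<P>"
    using P PM P_ac by (intro measure_in_space_E) unfold_locales
  have Q_E: "measure Q \<in> space_E M \<P>" if Q: "Q \<in> \<Q>" for Q
  proof -
    obtain R where "R \<in> \<P>" "absolutely_continuous R Q"
      using assms(7) Q unfolding dominated_by_def by blast
    moreover have "Q \<in> space (prob_algebra M)"
      using assms(4) Q by blast
    ultimately show ?thesis
      using prob_algebraD by (intro measure_in_space_E)
  qed
  have "\<exists>\<phi>\<in>?K. \<forall>q\<in>measure ` \<Q>. 2 * \<epsilon> \<le> \<phi> q"
  proof (rule minimax)
    show "measure ` \<Q> \<noteq> {}"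
      using assms(5) by simp
    show "compact ?K"
      by (intro compact_Int_closed compact_test_functionals closed_Collect_le
          continuous_on_const continuous_on_product_coordinates)
    show "(\<lambda>i. t * \<phi> i + (1 - t) * \<psi> i) \<in> ?K"
      if "\<phi> \<in> ?K" "\<psi> \<in> ?K" "t \<in> {0..1}" for \<phi> \<psi> t
    proof -
      have "t * \<phi> (measure P) + (1 - t) * \<psi> (measure P) \<le> t * (\<epsilon> * \<delta>) + (1 - t) * (\<epsilon> * \<delta>)"
        using that by (intro add_mono mult_left_mono) auto
      then show ?thesis
        using that convex_test_functionals[of \<phi> M \<P> \<psi> t] by (simp add: algebra_simps)
    qed
    show "\<exists>s\<in>measure ` \<Q>. \<forall>\<phi>\<in>?K. \<phi> s = t * \<phi> q + (1 - t) * \<phi> r"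
      if qr: "q \<in> measure ` \<Q>" "r \<in> measure ` \<Q>" and t: "t \<in> {0..1}" for q r t
    proof -
      obtain Q R where Q: "Q \<in> \<Q>" "q = measure Q" and R: "R \<in> \<Q>" "r = measure R"
        using qr by blast
      have "mixture M t Q R \<in> \<Q>"
        using assms(6) Q R t unfolding convex_measures_def by blast
      moreover have "measure (mixture M t Q R) = (\<lambda>A. t * q A + (1 - t) * r A)"
        using measure_mixture[of Q M R t] Q R t assms(4) by auto
      moreover have "\<phi> (\<lambda>A. t * q A + (1 - t) * r A) = t * \<phi> q + (1 - t) * \<phi> r" if "\<phi> \<in> ?K" for \<phi>
      proof -
        have "\<phi> (\<lambda>A. t * q A + (1 - t) * r A) = \<phi> (\<lambda>A. t * q A) + \<phi> (\<lambda>A. (1 - t) * r A)"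
          using that Q_E[OF Q(1)] Q_E[OF R(1)] Q(2) R(2) space_E_scale[of _ M \<P>]
          by (simp add: test_functionals_def)
        also have "\<dots> = t * \<phi> q + (1 - t) * \<phi> r"
          using that Q_E[OF Q(1)] Q_E[OF R(1)] Q(2) R(2) by (simp add: test_functionals_def)
        finally show ?thesis .
      qed
      ultimately show ?thesis
        by (intro bexI[of _ "measure (mixture M t Q R)"] ballI imageI) auto
    qed
    show "\<exists>\<phi>\<in>?K. 2 * \<epsilon> \<le> \<phi> q" if q: "q \<in> measure ` \<Q>" for q
    proof -
      obtain Q where Q: "Q \<in> \<Q>" "q = measure Q"
        using q by blast
      \<comment> \<open>The set \<open>A\<close> depends on \<open>Q\<close>; minimax will replace
        these evaluations by one functional valid for every \<open>Q\<close>.\<close>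
      obtain A where A: "A \<in> sets M" "measure P A < \<epsilon> * \<delta>" "2 * \<epsilon> \<le> measure Q A"
        using contra Q(1) by (meson not_less)
      show ?thesis
        using A P_E Q_E[OF Q(1)] Q(2) evaluation_in_test_functionals[OF assms(1,3) A(1)]
        by (intro bexI[of _ "\<lambda>\<mu>\<in>space_E M \<P>. \<mu> A"]) auto
    qed
  qed
  then obtain \<phi> where test: "\<phi> \<in> test_functionals M \<P>" and \<phi>_P: "\<phi> (measure P) \<le> \<epsilon> * \<delta>"
    and \<phi>_Q: "\<And>Q. Q \<in> \<Q> \<Longrightarrow> 2 * \<epsilon> \<le> \<phi> (measure Q)"
    by auto
  \<comment> \<open>Compactness gives only an abstract functional; surjectivity of \<open>l\<close>
    turns it into a function, whose level set can be fed to the separation hypothesis.\<close>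
  have "\<phi> \<in> l_map M \<P> ` L_infty M \<P>"
    using test test_functionals_subset_dual_E[OF assms(1,3)] assms(8) by blast
  then obtain X where X: "X \<in> calL_infty M \<P>" and \<phi>: "\<phi> = l_rep M \<P> X"
    using l_map_representative[OF assms(1)] by (metis imageE)
  note bounds = l_rep_test_functional_bounds[OF assms(1) X test[unfolded \<phi>]]
  have [measurable]: "X \<in> borel_measurable M"
    using X by (simp add: calL_infty_def)
  define A where "A = {\<omega>\<in>space M. \<epsilon> < X \<omega>}"
  have A [measurable]: "A \<in> sets M"
    unfolding A_def by measurable
  have "measure P A < \<delta>"
  proof (rule ccontr)
    assume large: "\<not> measure P A < \<delta>"
    \<comment> \<open>The equality case of Markov's inequality must be excluded. If P(A) \<ge>
      \<delta>, then \<open>?f\<close> is nonnegative almost everywhere with integral at most 0,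
      hence 0 almost everywhere; as it is positive on \<open>A\<close>, this gives P(A) = 0 <
      \<delta>.\<close>
    let ?f = "\<lambda>\<omega>. X \<omega> - \<epsilon> * indicator A \<omega>"
    note P_bounds = bounds[OF P_in P P_ac]
    have A': "A \<in> sets P"
      using A PM by simp
    have ind: "integrable P (indicator A :: 'a \<Rightarrow> real)"
      using A' by (simp add: P.emeasure_eq_measure)
    have int: "integrable P ?f"
      using P_bounds(1) ind by simp
    have nonneg: "AE \<omega> in P. 0 \<le> ?f \<omega>"
      using P_bounds(3) by (rule AE_mp) (auto simp: A_def indicator_def)
    have "integral\<^sup>L P ?f = integral\<^sup>L P X - \<epsilon> * measure P A"
      using P_bounds(1) ind A' by (simp add: Bochner_Integration.integral_diff)
    also have "\<dots> \<le> \<epsilon> * \<delta> - \<epsilon> * measure P A"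
      using \<phi>_P P_bounds(2) by (simp add: \<phi>)
    also have "\<dots> \<le> 0"
      using large assms(9) by simp
    finally have "integral\<^sup>L P ?f = 0"
      using nonneg by (intro antisym integral_nonneg_AE)
    then have "AE \<omega> in P. ?f \<omega> = 0"
      using integral_nonneg_eq_0_iff_AE[OF int nonneg] by simp
    then have "AE \<omega> in P. \<omega> \<notin> A"
    proof eventually_elim
      case (elim \<omega>)
      have "\<omega> \<in> A \<Longrightarrow> \<epsilon> < X \<omega>"
        by (simp add: A_def)
      with elim show ?case
        by (cases "\<omega> \<in> A") simp_all
    qed
    then have "measure P A = 0"
      using A' by (simp add: P.prob_eq_0)
    then show False
      using large assms(10) by simp
  qed
  then obtain Q where Q: "Q \<in> \<Q>" and Q_A: "measure Q A < \<epsilon>"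
    using assms(11) A P by blast
  have Q_in: "Q \<in> space (prob_algebra M)"
    using assms(4) Q by blast
  interpret Q: prob_space Q
    by (rule prob_algebraD[OF Q_in])
  obtain R where R: "R \<in> \<P>" "absolutely_continuous R Q"
    using assms(7) Q unfolding dominated_by_def by blast
  note Q_bounds = bounds[OF Q_in R]
  have A': "A \<in> sets Q" and QM: "space Q = space M"
    using A prob_algebraD[OF Q_in] by auto
  have ind: "integrable Q (indicator A :: 'a \<Rightarrow> real)"
    using A' by (simp add: Q.emeasure_eq_measure)
  \<comment> \<open>Off \<open>A\<close> the function is at most \<epsilon>, and on \<open>A\<close>
    it is at most 1 almost everywhere.\<close>
  have "integral\<^sup>L Q X \<le> (\<integral>\<omega>. \<epsilon> + indicator A \<omega> \<partial>Q)"
  proof (rule integral_mono_AE)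
    show "AE \<omega> in Q. X \<omega> \<le> \<epsilon> + indicator A \<omega>"
      using Q_bounds(3) AE_space
    proof eventually_elim
      case (elim \<omega>)
      then show ?case
        using assms(9) QM by (auto simp: A_def indicator_def)
    qed
  qed (use Q_bounds(1) ind in auto)
  also have "\<dots> = \<epsilon> + measure Q A"
    using ind A' by (simp add: Q.prob_space)
  also have "\<dots> < 2 * \<epsilon>"
    using Q_A by simp
  finally show False
    using \<phi>_Q[OF Q] Q_bounds(2) by (simp add: \<phi>)
qed

end
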